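(* Let $f\colon[0,1)\to\mathbb{R}$ be a function and let $\epsilon\in(0,1)$, $a,b,r\in\mathbb{R}^+$ be constants such that $f$ is monotone increasing on $[0,\epsilon]$ and $a x^r\le f(x)\le b x^r$ for every $x\in[0,\epsilon]$. Let $m\ge 1$ and let $k_1\ge k_2\ge\dots\ge k_m>0$ be real numbers. Put $U_j=\sum_{i=j+1}^m k_i$ and $L_j=\sum_{i=1}^j k_i$ for $1\le j\le m$, and $$d_I=\sqrt[r]{\max_{1\le j\le m}\Big\{\frac{b k_j-aU_j}{b k_j+aL_j}\Big\}}.$$ If $d_I\le\epsilon$, then for every $x\in[d_I,\epsilon]$ the achievement set $E\bigl(w_n(x)\bigr)$ is a compact interval.
   Context: The achievement set of a summable sequence $(z_n)_{n\ge1}$ of non-negative reals is $E(z_n)=\{\sum_{n=1}^\infty c_n z_n : c_n\in\{0,1\}\}$. Given $f$ and $k_1,\dots,k_m$ as in the claim, the generalized multigeometric sequence is $w_n(x)=k_{g(n)}\,f\bigl(x^{\lfloor (m+n-1)/m\rfloor}\bigr)$ for $n\ge1$, where $g(n)=1+((n-1)\bmod m)$; that is, the sequence $k_1f(x),\dots,k_mf(x),k_1f(x^2),\dots,k_mf(x^2),\dots$. "Monotone increasing" on $[0,\epsilon]$ means $f(x)\le f(y)$ whenever $0\le x\le y\le\epsilon$. $\sqrt[r]{t}$ denotes $t^{1/r}$, with $r$ a positive real. An empty sum is $0$ (so $U_m=0$). *)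

theory Defs
  imports "HOL-Analysis.Analysis"
begin

text \<open>
  All sequences and finite families are indexed from 1; values at index 0 are never used.
\<close>

text \<open>
  Using \<^const>\<open>sums\<close> rather than \<^const>\<open>suminf\<close> means that divergent subseries contribute
  nothing; for a summable sequence of non-negative reals every choice of \<open>c\<close> gives a sum.
\<close>

definition achievement_set :: "(nat \<Rightarrow> real) \<Rightarrow> real set" where
  "achievement_set z =
     {s. \<exists>c :: nat \<Rightarrow> real. (\<forall>n\<ge>1. c n \<in> {0, 1}) \<and> (\<lambda>n. c (Suc n) * z (Suc n)) sums s}"

text \<open>
  The sequence \<open>k 1 * f x, \<dots>, k m * f x, k 1 * f (x ^ 2), \<dots>, k m * f (x ^ 2), \<dots>\<close>.
  The exponent is the floor of \<open>(m + n - 1) / m\<close>; for \<open>n \<ge> 1\<close> no subtraction on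
  \<^typ>\<open>nat\<close> truncates.
\<close>

definition gen_multigeometric ::
    "(real \<Rightarrow> real) \<Rightarrow> nat \<Rightarrow> (nat \<Rightarrow> real) \<Rightarrow> real \<Rightarrow> nat \<Rightarrow> real" where
  "gen_multigeometric f m k x n = k (1 + (n - 1) mod m) * f (x ^ ((m + n - 1) div m))"

definition upper_sum :: "nat \<Rightarrow> (nat \<Rightarrow> real) \<Rightarrow> nat \<Rightarrow> real" where
  "upper_sum m k j = (\<Sum>i = j + 1..m. k i)"

definition lower_sum :: "(nat \<Rightarrow> real) \<Rightarrow> nat \<Rightarrow> real" where
  "lower_sum k j = (\<Sum>i = 1..j. k i)"

text \<open>
  The real exponent \<open>1 / r\<close> is that of the \<open>r\<close>-th root. For positive \<open>a\<close>, \<open>b\<close>, \<open>k\<close> the maximum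
  is positive, since its \<open>j = m\<close> entry is \<open>b * k m / (b * k m + a * lower_sum k m)\<close>.
\<close>

definition d_I :: "real \<Rightarrow> real \<Rightarrow> real \<Rightarrow> nat \<Rightarrow> (nat \<Rightarrow> real) \<Rightarrow> real" where
  "d_I a b r m k =
     (MAX j\<in>{1..m}. (b * k j - a * upper_sum m k j) / (b * k j + a * lower_sum k j)) powr (1 / r)"

end

theory Submission
  imports Defs
begin

text \<open>
  Call a summable sequence of non-negative terms slowly decaying if each term is at most the sum of
  all later terms. Kakeya's theorem says that the achievement set is then the whole interval from
  \<open>0\<close> to the total sum: the greedy algorithm takes a term whenever it still fits, and slow decay
  guarantees that what is left to be represented never exceeds what the later terms can supply
  (\<open>achievement_set_slowly_decaying\<close>).

  It remains to see that \<open>w\<^sub>n(x)\<close> decays slowly. Put \<open>y = x powr r\<close>. The power bounds on \<open>f\<close> put the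
  term \<open>k\<^sub>j f(x\<^sup>p)\<close> below \<open>b k\<^sub>j y\<^sup>p\<close>, and each later term \<open>k\<^sub>i f(x\<^sup>q)\<close> above
  \<open>a k\<^sub>i y\<^sup>q\<close>. The sequence with terms \<open>k\<^sub>j y\<^sup>p\<close>, in the same order, is multiplied by \<open>y\<close> under a shift
  by \<open>m\<close>, so its tail after position \<open>(p, j)\<close> is the sum of the next \<open>m\<close> terms divided by \<open>1 - y\<close>,
  namely \<open>y\<^sup>p (U\<^sub>j + y L\<^sub>j) / (1 - y)\<close> (\<open>multigeometric_tail\<close>). Hence slow decay
  follows from \<open>b k\<^sub>j (1 - y) \<le> a (U\<^sub>j + y L\<^sub>j)\<close>, which rearranges to
  \<open>y \<ge> (b k\<^sub>j - a U\<^sub>j) / (b k\<^sub>j + a L\<^sub>j)\<close>. All \<open>m\<close> of these conditions together say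
  \<open>x \<ge> d\<^sub>I\<close>.
\<close>

section \<open>Kakeya's theorem for achievement sets\<close>

primrec greedy_rest :: "(nat \<Rightarrow> real) \<Rightarrow> real \<Rightarrow> nat \<Rightarrow> real" where
  "greedy_rest u s 0 = s"
| "greedy_rest u s (Suc n) =
     (if u n \<le> greedy_rest u s n then greedy_rest u s n - u n else greedy_rest u s n)"

lemma suminf_tail_Suc:
  fixes u :: "nat \<Rightarrow> real"
  assumes "summable u"
  shows "(\<Sum>i. u (i + n)) = u n + (\<Sum>i. u (i + Suc n))"
  using suminf_split_head[of "\<lambda>i. u (i + n)"] assms by (simp add: summable_iff_shift)

lemma suminf_tail_tendsto_0:
  fixes u :: "nat \<Rightarrow> real"
  assumes "summable u"
  shows "(\<lambda>n. \<Sum>i. u (i + n)) \<longlonglongrightarrow> 0"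
proof -
  have "(\<lambda>n. suminf u - (\<Sum>i<n. u i)) \<longlonglongrightarrow> suminf u - suminf u"
    by (intro tendsto_intros summable_LIMSEQ assms)
  then show ?thesis
    using assms by (simp add: suminf_minus_initial_segment)
qed

text \<open>
  The upper bound is where slow decay enters. A term that is taken reduces the rest and the tail
  by the same amount; a term that is skipped exceeds the rest, and is itself at most the new tail.
\<close>

lemma greedy_rest_bounds:
  fixes u :: "nat \<Rightarrow> real"
  assumes "summable u"
    and slow: "\<And>n. u n \<le> (\<Sum>i. u (i + Suc n))"
    and "0 \<le> s" "s \<le> suminf u"
  shows "0 \<le> greedy_rest u s n \<and> greedy_rest u s n \<le> (\<Sum>i. u (i + n))"
proof (induction n)
  case 0
  then show ?case using assms by simp
next
  case (Suc n)
  then show ?case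
    using slow[of n] suminf_tail_Suc[OF assms(1), of n] by auto
qed

lemma achievement_set_slowly_decaying:
  fixes z :: "nat \<Rightarrow> real"
  defines "u \<equiv> \<lambda>n. z (Suc n)"
  assumes summ: "summable u"
    and nonneg: "\<And>n. 0 \<le> u n"
    and slow: "\<And>n. u n \<le> (\<Sum>i. u (i + Suc n))"
  shows "achievement_set z = {0..suminf u}"
proof (intro equalityI subsetI)
  fix s assume "s \<in> achievement_set z"
  then obtain c :: "nat \<Rightarrow> real" where c: "\<forall>n\<ge>1. c n \<in> {0, 1}"
    and s: "(\<lambda>n. c (Suc n) * u n) sums s"
    unfolding achievement_set_def u_def by blast
  have c01: "c (Suc n) = 0 \<or> c (Suc n) = 1" for n
    using c by auto
  have "0 \<le> c (Suc n) * u n" "c (Suc n) * u n \<le> u n" for n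
    using c01[of n] nonneg[of n] by auto
  then show "s \<in> {0..suminf u}"
    using sums_le[OF _ sums_zero s] sums_le[OF _ s summable_sums[OF summ]] by auto
next
  fix s assume s: "s \<in> {0..suminf u}"
  let ?t = "greedy_rest u s"
  define c :: "nat \<Rightarrow> real" where "c = (\<lambda>n. if u (n - 1) \<le> ?t (n - 1) then 1 else 0)"
  have partial: "(\<Sum>i<n. c (Suc i) * u i) = s - ?t n" for n
    by (induction n) (auto simp: c_def)
  have bounds: "0 \<le> ?t n \<and> ?t n \<le> (\<Sum>i. u (i + n))" for n
    using greedy_rest_bounds[OF summ slow] s by auto
  have "?t \<longlonglongrightarrow> 0"
    by (rule tendsto_sandwich[OF _ _ tendsto_const suminf_tail_tendsto_0[OF summ]])
       (use bounds in auto)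
  then have "(\<lambda>n. s - ?t n) \<longlonglongrightarrow> s - 0"
    by (intro tendsto_intros)
  then have "(\<lambda>n. c (Suc n) * u n) sums s"
    by (simp add: sums_def partial)
  moreover have "\<forall>n\<ge>1. c n \<in> {0, 1}"
    by (simp add: c_def)
  ultimately show "s \<in> achievement_set z"
    unfolding achievement_set_def u_def by blast
qed

section \<open>Tails of multigeometric sequences\<close>

text \<open>The sequence for \<open>f = id\<close>, with indices from \<open>0\<close> so that position \<open>n\<close> splits as \<open>n div m\<close> and
  \<open>n mod m\<close>.\<close>

definition multigeometric :: "nat \<Rightarrow> (nat \<Rightarrow> real) \<Rightarrow> real \<Rightarrow> nat \<Rightarrow> real" where
  "multigeometric m k y n = k (Suc (n mod m)) * y ^ Suc (n div m)"

lemma gen_multigeometric_Suc: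
  assumes "1 \<le> m"
  shows "gen_multigeometric f m k x (Suc n) = k (Suc (n mod m)) * f (x ^ Suc (n div m))"
  using assms by (simp add: gen_multigeometric_def)

lemma multigeometric_shift:
  assumes "1 \<le> m"
  shows "multigeometric m k y (n + m) = y * multigeometric m k y n"
  using assms by (simp add: multigeometric_def)

text \<open>Since \<open>n \<le> m * Suc (n div m)\<close>, the sequence is dominated by a geometric one with ratio
  the \<open>m\<close>-th root of \<open>y\<close>.\<close>

lemma summable_multigeometric:
  assumes "1 \<le> m" "0 < y" "y < 1"
  shows "summable (multigeometric m k y)"
proof -
  define s where "s = root m y"
  have s: "0 < s" "s < 1" "s ^ m = y"
    using assms by (auto simp: s_def)
  define B where "B = (\<Sum>i<m. \<bar>k (Suc i)\<bar>)"
  have "norm (multigeometric m k y n) \<le> B * s ^ n" for n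
  proof -
    have "\<bar>k (Suc (n mod m))\<bar> \<le> B"
      unfolding B_def using assms(1)
      by (intro member_le_sum[where f = "\<lambda>i. \<bar>k (Suc i)\<bar>"]) auto
    moreover have "n \<le> m * Suc (n div m)"
      using assms(1) dividend_less_times_div[of m n] by simp
    then have "s ^ (m * Suc (n div m)) \<le> s ^ n"
      using s by (intro power_decreasing) auto
    then have "y ^ Suc (n div m) \<le> s ^ n"
      by (simp only: power_mult s)
    ultimately have "\<bar>k (Suc (n mod m))\<bar> * y ^ Suc (n div m) \<le> B * s ^ n"
      using assms by (intro mult_mono) auto
    then show ?thesis
      using assms by (simp add: multigeometric_def abs_mult)
  qed
  moreover have "summable (\<lambda>n. B * s ^ n)"
    using s by (intro summable_mult summable_geometric) auto
  ultimately show ?thesis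
    by (rule summable_comparison_test'[rotated])
qed

text \<open>
  The \<open>m\<close> terms after position \<open>q * m + l\<close> finish the current block, contributing the coefficients
  of \<open>U\<close>, and then start the next one, contributing those of \<open>L\<close> with one more factor \<open>y\<close>.
\<close>

lemma sum_next_period:
  assumes "l < m"
  shows "(\<Sum>i<m. multigeometric m k y (i + Suc (q * m + l)))
       = y ^ Suc q * (upper_sum m k (Suc l) + y * lower_sum k (Suc l))"
proof -
  let ?v = "multigeometric m k y"
  have v: "?v (q' * m + i) = y ^ Suc q' * k (Suc i)" if "i < m" for i q'
    using that by (simp add: multigeometric_def)
  have "(\<Sum>i<m. ?v (i + Suc (q * m + l))) = (\<Sum>i = Suc l..<Suc l + m. ?v (q * m + i))"
    by (rule sum.reindex_bij_witness[of _ "\<lambda>i. i - Suc l" "\<lambda>i. i + Suc l"])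
       (auto simp: add_ac)
  also have "\<dots> = (\<Sum>i = Suc l..<m. ?v (q * m + i)) + (\<Sum>i = m..<Suc l + m. ?v (q * m + i))"
    using assms by (intro sum.atLeastLessThan_concat[symmetric]) auto
  also have "(\<Sum>i = m..<Suc l + m. ?v (q * m + i)) = (\<Sum>i<Suc l. ?v (Suc q * m + i))"
    by (rule sum.reindex_bij_witness[of _ "\<lambda>i. i + m" "\<lambda>i. i - m"])
       (auto simp: add_ac)
  also have "\<dots> = (\<Sum>i<Suc l. y ^ Suc (Suc q) * k (Suc i))"
    using assms by (intro sum.cong v) auto
  also have "\<dots> = y ^ Suc (Suc q) * lower_sum k (Suc l)"
    by (simp only: lower_sum_def sum_distrib_left One_nat_def sum.atLeast1_atMost_eq)
  also have "(\<Sum>i = Suc l..<m. ?v (q * m + i)) = (\<Sum>i = Suc l..<m. y ^ Suc q * k (Suc i))"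
    by (intro sum.cong v) auto
  also have "\<dots> = y ^ Suc q * upper_sum m k (Suc l)"
    unfolding upper_sum_def sum_distrib_left[symmetric]
    using sum.shift_bounds_Suc_ivl[of k "Suc l" m]
    by (simp add: atLeastLessThanSuc_atLeastAtMost)
  finally show ?thesis
    by (simp add: algebra_simps)
qed

lemma multigeometric_tail:
  assumes "l < m" "0 < y" "y < 1"
  shows "(1 - y) * (\<Sum>i. multigeometric m k y (i + Suc (q * m + l)))
       = y ^ Suc q * (upper_sum m k (Suc l) + y * lower_sum k (Suc l))"
proof -
  let ?v = "multigeometric m k y" and ?w = "\<lambda>i. multigeometric m k y (i + Suc (q * m + l))"
  have m: "1 \<le> m" using assms by simp
  have "summable ?w"
    using summable_multigeometric[OF m assms(2,3)] by (subst summable_iff_shift)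
  then have "suminf ?w = (\<Sum>i. ?w (i + m)) + (\<Sum>i<m. ?w i)"
    by (rule suminf_split_initial_segment)
  moreover have "?w (i + m) = y * ?w i" for i
    using multigeometric_shift[OF m, of k y "i + Suc (q * m + l)"] by (simp add: add_ac)
  then have "(\<Sum>i. ?w (i + m)) = y * suminf ?w"
    using \<open>summable ?w\<close> by (simp add: suminf_mult del: add_Suc_right)
  ultimately show ?thesis
    using sum_next_period[OF assms(1), of k y q] by (simp add: algebra_simps)
qed

section \<open>Achievement sets of generalized multigeometric sequences\<close>

text \<open>The maximum is positive, which makes \<open>x\<close> positive and lets the exponents \<open>1 / r\<close> and \<open>r\<close>
  cancel.\<close>

lemma d_I_le_imp_ratio_le:
  assumes "1 \<le> m" "0 < a" "0 < b" "0 < r" "\<And>j. j \<in> {1..m} \<Longrightarrow> 0 < k j"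
    and "d_I a b r m k \<le> x"
  shows "0 < x"
    and "\<And>j. j \<in> {1..m} \<Longrightarrow>
           (b * k j - a * upper_sum m k j) / (b * k j + a * lower_sum k j) \<le> x powr r"
proof -
  let ?q = "\<lambda>j. (b * k j - a * upper_sum m k j) / (b * k j + a * lower_sum k j)"
  let ?M = "MAX j\<in>{1..m}. ?q j"
  have le_M: "?q j \<le> ?M" if "j \<in> {1..m}" for j
    using that by (intro Max_ge) auto
  have "0 < lower_sum k m"
    unfolding lower_sum_def using assms by (intro sum_pos) auto
  \<comment> \<open>The last entry is positive because \<open>U\<^sub>m\<close> is an empty sum.\<close>
  then have "0 < ?q m"
    using assms by (auto simp: upper_sum_def intro!: divide_pos_pos add_pos_pos)
  then have M: "0 < ?M"
    by (rule less_le_trans[OF _ le_M]) (use assms(1) in simp)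
  then show "0 < x"
    using assms(6) unfolding d_I_def by (smt (verit) powr_gt_zero)
  have "?M = (?M powr (1 / r)) powr r"
    using M assms(4) by (simp add: powr_powr)
  also have "\<dots> \<le> x powr r"
    using assms(4,6) unfolding d_I_def by (intro powr_mono2) auto
  finally show "?q j \<le> x powr r" if "j \<in> {1..m}" for j
    using le_M[OF that] by linarith
qed

theorem theorem2p8:
  fixes f :: "real \<Rightarrow> real" and \<epsilon> a b r :: real
    and m :: nat and k :: "nat \<Rightarrow> real"
  assumes "0 < \<epsilon>" and "\<epsilon> < 1"
    and "0 < a" and "0 < b" and "0 < r"
    and "mono_on {0..\<epsilon>} f"
    and "\<And>x. x \<in> {0..\<epsilon>} \<Longrightarrow> a * x powr r \<le> f x \<and> f x \<le> b * x powr r"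
    and "1 \<le> m"
    and "antimono_on {1..m} k" and "0 < k m"
    and "d_I a b r m k \<le> \<epsilon>"
  shows "\<forall>x\<in>{d_I a b r m k..\<epsilon>}.
           \<exists>u v. u \<le> v \<and> achievement_set (gen_multigeometric f m k x) = {u..v}"
proof
  fix x assume x: "x \<in> {d_I a b r m k..\<epsilon>}"
  have k_pos: "0 < k j" if "j \<in> {1..m}" for j
    using monotone_onD[OF assms(9), of j m] that assms(8,10) by auto
  note ratio = d_I_le_imp_ratio_le[of m a b r k x]
  have "0 < x"
    using ratio(1) assms x k_pos by auto
  define y where "y = x powr r"
  have y: "0 < y" "y < 1"
    using \<open>0 < x\<close> x assms by (auto simp: y_def powr01_less_one)
  let ?z = "gen_multigeometric f m k x" and ?v = "multigeometric m k y"
  define u where "u = (\<lambda>n. ?z (Suc n))"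
  have f_power: "a * y ^ Suc p \<le> f (x ^ Suc p) \<and> f (x ^ Suc p) \<le> b * y ^ Suc p" for p
  proof -
    have "x ^ Suc p \<le> x"
      using \<open>0 < x\<close> x assms power_decreasing[of 1 "Suc p" x] by (simp del: power_Suc)
    then have "x ^ Suc p \<in> {0..\<epsilon>}"
      using \<open>0 < x\<close> x by (simp del: power_Suc)
    moreover have "(x ^ Suc p) powr r = y ^ Suc p"
      using \<open>0 < x\<close> unfolding y_def
      by (simp add: powr_realpow[symmetric] powr_powr mult.commute del: power_Suc)
    ultimately show ?thesis
      using assms(7) by metis
  qed
  have kn: "0 < k (Suc (n mod m))" for n
    using k_pos assms(8) by (simp add: Suc_le_eq)
  have u: "a * ?v n \<le> u n" "u n \<le> b * ?v n" for n
    using f_power[of "n div m"] kn[of n] unfolding u_def gen_multigeometric_Suc[OF assms(8)]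
    by (auto simp: multigeometric_def mult.left_commute simp del: power_Suc
        intro!: mult_left_mono)
  have v_pos: "0 < ?v n" for n
    using kn y by (simp add: multigeometric_def)
  have nonneg: "0 \<le> u n" for n
    using u(1)[of n] v_pos[of n] assms(3) by (smt (verit) mult_pos_pos)
  have summ_v: "summable ?v"
    by (rule summable_multigeometric[OF assms(8) y])
  have summ: "summable u"
    by (rule summable_comparison_test[of _ "\<lambda>n. b * ?v n"])
       (use u nonneg summ_v in \<open>auto intro: summable_mult\<close>)
  have slow: "u n \<le> (\<Sum>i. u (i + Suc n))" for n
  proof -
    define q l where "q = n div m" and "l = n mod m"
    have l: "l < m" and n: "n = q * m + l"
      using assms(8) by (auto simp: q_def l_def)
    let ?U = "upper_sum m k (Suc l)" and ?L = "lower_sum k (Suc l)"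
    let ?T = "\<Sum>i. ?v (i + Suc n)"
    have j: "Suc l \<in> {1..m}"
      using l by simp
    have "0 < ?L"
      unfolding lower_sum_def using l by (intro sum_pos k_pos) auto
    then have "0 < b * k (Suc l) + a * ?L"
      using k_pos[OF j] assms by (simp add: add_pos_pos)
    then have "b * k (Suc l) - a * ?U \<le> y * (b * k (Suc l) + a * ?L)"
      using ratio(2)[OF _ _ _ _ _ _ j] assms x k_pos
      by (simp add: y_def pos_divide_le_eq)
    then have "(1 - y) * (b * k (Suc l)) \<le> a * (?U + y * ?L)"
      by (simp add: algebra_simps)
    then have "y ^ Suc q * ((1 - y) * (b * k (Suc l))) \<le> y ^ Suc q * (a * (?U + y * ?L))"
      using y by (intro mult_left_mono) auto
    also have "\<dots> = (1 - y) * (a * ?T)"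
      using multigeometric_tail[OF l y, of k q] by (simp add: n mult.left_commute)
    also have "y ^ Suc q * ((1 - y) * (b * k (Suc l))) = (1 - y) * (b * ?v n)"
      by (simp add: multigeometric_def q_def l_def)
    finally have "b * ?v n \<le> a * ?T"
      using y by simp
    also have "a * ?T = (\<Sum>i. a * ?v (i + Suc n))"
      using summ_v by (intro suminf_mult[symmetric]) (simp only: summable_iff_shift)
    also have "\<dots> \<le> (\<Sum>i. u (i + Suc n))"
    proof (rule suminf_le)
      show "summable (\<lambda>i. a * ?v (i + Suc n))"
        using summ_v by (intro summable_mult) (simp only: summable_iff_shift)
      show "summable (\<lambda>i. u (i + Suc n))"
        using summ by (simp only: summable_iff_shift)
    qed (rule u)
    finally show ?thesis
      using u(2)[of n] by linarith
  qed
  have "achievement_set ?z = {0..suminf u}"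
    using achievement_set_slowly_decaying[of ?z] summ nonneg slow by (simp add: u_def)
  moreover have "0 \<le> suminf u"
    by (rule suminf_nonneg[OF summ nonneg])
  ultimately show "\<exists>u v. u \<le> v \<and> achievement_set ?z = {u..v}"
    by blast
qed

end
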